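(* Let $X$ and $Z$ be Hausdorff topological vector spaces, let $C\subseteq Z$ be a convex and pointed cone with nonempty interior, and let $K$ be a nonempty, convex and closed subset of $X$. Consider a mapping $F:K\times K\times K\to Z$ satisfying: (i) for every $y\in K$, one of the following conditions is satisfied: (a) for every net $(x_\alpha)\subseteq K$ with $\lim x_\alpha=x$: if $F(x_\alpha,y,x_\alpha)\notin-\operatorname{int}C$ for all $\alpha$, then $F(x,y,x)\notin-\operatorname{int}C$; (b) the mapping $x\mapsto F(x,y,x)$ is $C$-upper semicontinuous on $K$; (c) for every $x\in K$ and every net $(x_\alpha)\subseteq K$ with $\lim x_\alpha=x$ there exists a net $(z_\alpha)\subseteq Z$ with $\lim z_\alpha=z$ such that $F(x_\alpha,y,x_\alpha)-z_\alpha\in-C$ and $F(x,y,x)-z\in C$; (ii) for every $x\in K$, the mapping $y\mapsto F(x,y,x)$ is $C$-convex; (iii) for every $x\in K$, $F(x,x,x)\notin-\operatorname{int}C$; (iv) there exist a nonempty compact set $K_0\subseteq X$ and $y_0\in K$ such that $F(x,y_0,x)\in-\operatorname{int}C$ for all $x\in K\setminus K_0$. Then there exists an element $x_0\in K$ such that $F(x_0,y,x_0)\notin-\operatorname{int}C$ for all $y\in K$.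
   Context: All spaces are real. A cone $C$ satisfies $tc\in C$ for all $c\in C$, $t\ge 0$; it is convex if $C+C=C$ and pointed if $C\cap(-C)=\{0\}$ ($C$ is not assumed closed). $\operatorname{int}C$ is the interior of $C$. A map $f:K\to Z$ is $C$-upper semicontinuous at $x\in K$ if for any neighborhood $V$ of $f(x)$ there exists a neighborhood $U$ of $x$ such that $f(u)\in V-C$ for all $u\in U\cap K$; it is $C$-upper semicontinuous on $K$ if this holds at every $x\in K$. A map $f:K\to Z$ ($K$ convex) is $C$-convex if $tf(x)+(1-t)f(y)-f(tx+(1-t)y)\in C$ for all $x,y\in K$, $t\in[0,1]$. *)

theory Defs
  imports "HOL-Analysis.Analysis" "HOL-Library.Set_Algebras"
begin

text \<open>The library has topological groups as a type class but no general (not necessarily normed)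
  topological vector spaces. Hausdorffness is not part of the class; it is added through the sort
  constraint \<open>t2_space\<close> where it is needed.\<close>

class real_topological_vector_space = real_vector + topological_ab_group_add +
  assumes tendsto_scaleR_Pair: "LIM p (nhds a \<times>\<^sub>F nhds x). fst p *\<^sub>R snd p :> nhds (a *\<^sub>R x)"

instance real_normed_vector < real_topological_vector_space
proof
  fix a :: real and x :: 'a
  show "((\<lambda>p. fst p *\<^sub>R snd p) \<longlongrightarrow> a *\<^sub>R x) (nhds a \<times>\<^sub>F nhds x)"
    unfolding nhds_prod[symmetric]
    using tendsto_scaleR[OF tendsto_fst[OF filterlim_ident] tendsto_snd[OF filterlim_ident],
        of "(a, x)"] by simp
qed

text \<open>The library predicate \<open>cone\<close> is closure under multiplication by all scalars \<open>t \<ge> 0\<close>.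
  The sum below is the Minkowski sum.\<close>

definition convex_pointed_cone :: "'z::real_vector set \<Rightarrow> bool" where
  "convex_pointed_cone C \<longleftrightarrow> cone C \<and> C + C = C \<and> C \<inter> uminus ` C = {0}"

text \<open>The index set of a net is a nonempty set \<open>D\<close> directed by a preorder \<open>r\<close>, where
  \<open>(d, e) \<in> r\<close> means that \<open>e\<close> is at least as large as \<open>d\<close>.\<close>

definition directed_set :: "'i set \<Rightarrow> ('i \<times> 'i) set \<Rightarrow> bool" where
  "directed_set D r \<longleftrightarrow>
     D \<noteq> {} \<and> preorder_on D r \<and> (\<forall>d\<in>D. \<forall>e\<in>D. \<exists>k\<in>D. (d, k) \<in> r \<and> (e, k) \<in> r)"

text \<open>The filter generated by the tails of a directed set: a net \<open>u\<close> indexed by \<open>(D, r)\<close> converges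
  to \<open>l\<close> iff \<open>(u \<longlongrightarrow> l) (net_filter D r)\<close>.\<close>

definition net_filter :: "'i set \<Rightarrow> ('i \<times> 'i) set \<Rightarrow> 'i filter" where
  "net_filter D r = (INF d\<in>D. principal {e \<in> D. (d, e) \<in> r})"

lemma eventually_net_filter:
  assumes "directed_set D r"
  shows "eventually P (net_filter D r) \<longleftrightarrow> (\<exists>d\<in>D. \<forall>e\<in>D. (d, e) \<in> r \<longrightarrow> P e)"
proof -
  have "eventually P (net_filter D r) \<longleftrightarrow>
      (\<exists>d\<in>D. eventually P (principal {e \<in> D. (d, e) \<in> r}))"
    unfolding net_filter_def
  proof (rule eventually_INF_base)
    show "D \<noteq> {}" using assms by (simp add: directed_set_def)
  next
    fix a b assume "a \<in> D" "b \<in> D"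
    then obtain k where k: "k \<in> D" "(a, k) \<in> r" "(b, k) \<in> r"
      using assms unfolding directed_set_def by blast
    have "trans r" using assms by (simp add: directed_set_def preorder_on_def)
    then have "{e \<in> D. (k, e) \<in> r} \<subseteq> {e \<in> D. (a, e) \<in> r} \<inter> {e \<in> D. (b, e) \<in> r}"
      using k by (auto dest: transD)
    then show "\<exists>k\<in>D. principal {e \<in> D. (k, e) \<in> r}
        \<le> inf (principal {e \<in> D. (a, e) \<in> r}) (principal {e \<in> D. (b, e) \<in> r})"
      using k(1) by auto
  qed
  then show ?thesis by (auto simp: eventually_principal)
qed

lemma tendsto_net_filter:
  assumes "directed_set D r"
  shows "(u \<longlongrightarrow> l) (net_filter D r) \<longleftrightarrow>
    (\<forall>V. open V \<longrightarrow> l \<in> V \<longrightarrow> (\<exists>d\<in>D. \<forall>e\<in>D. (d, e) \<in> r \<longrightarrow> u e \<in> V))"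
  by (simp add: tendsto_def eventually_net_filter[OF assms])

text \<open>HOL cannot quantify over the index types of nets inside a formula, so in hypotheses of the form
  \<open>for every net in X\<close> the index sets range over all directed sets whose elements are pairs of a
  subset and a point of \<open>X\<close>. Requiring the property for these nets only is implied by requiring it
  for all nets, so a theorem with such a hypothesis is at least as strong as one with
  the unrestricted hypothesis. The type is large enough to contain the
  neighbourhood-indexed nets, hence to describe closures, as the lemma below shows.\<close>

type_synonym 'x net_index = "'x set \<times> 'x"

lemma closure_net:
  fixes x :: "'x::topological_space"
  shows "x \<in> closure S \<longleftrightarrow>
    (\<exists>(D :: 'x net_index set) r u. directed_set D r \<and> u ` D \<subseteq> S \<and> (u \<longlongrightarrow> x) (net_filter D r))"
    (is "_ \<longleftrightarrow> ?R")
proof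
  assume x: "x \<in> closure S"
  define D :: "'x net_index set" where "D = {(U, s). open U \<and> x \<in> U \<and> s \<in> U \<inter> S}"
  define r :: "('x net_index \<times> 'x net_index) set"
    where "r = {(d, e). d \<in> D \<and> e \<in> D \<and> fst e \<subseteq> fst d}"
  have ex: "\<exists>s. (U, s) \<in> D" if "open U" "x \<in> U" for U
  proof -
    have "U \<inter> S \<noteq> {}"
      using open_Int_closure_eq_empty[OF that(1), of S] x that(2) by auto
    then show ?thesis using that by (auto simp: D_def)
  qed
  have dir: "directed_set D r"
    unfolding directed_set_def preorder_on_def
  proof (intro conjI ballI)
    show "D \<noteq> {}" using ex[of UNIV] by auto
    show "r \<subseteq> D \<times> D" "refl_on D r" "trans r"
      by (auto simp: r_def refl_on_def trans_def)
    fix d e assume de: "d \<in> D" "e \<in> D"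
    then obtain s where "(fst d \<inter> fst e, s) \<in> D"
      using ex[of "fst d \<inter> fst e"] unfolding D_def by fastforce
    then show "\<exists>k\<in>D. (d, k) \<in> r \<and> (e, k) \<in> r"
      using de by (intro bexI[of _ "(fst d \<inter> fst e, s)"]) (auto simp: r_def)
  qed
  have "(snd \<longlongrightarrow> x) (net_filter D r)"
    unfolding tendsto_net_filter[OF dir]
  proof (intro allI impI)
    fix V assume "open V" "x \<in> V"
    then obtain s where s: "(V, s) \<in> D" using ex by blast
    show "\<exists>d\<in>D. \<forall>e\<in>D. (d, e) \<in> r \<longrightarrow> snd e \<in> V"
      using s by (intro bexI[of _ "(V, s)"]) (auto simp: r_def D_def)
  qed
  moreover have "snd ` D \<subseteq> S" by (auto simp: D_def)
  ultimately show ?R using dir by (intro exI[of _ D] exI[of _ r] exI[of _ snd] conjI)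
next
  assume ?R
  then obtain D :: "'x net_index set" and r u where dir: "directed_set D r"
    and S: "u ` D \<subseteq> S" and lim: "(u \<longlongrightarrow> x) (net_filter D r)" by (elim exE conjE)
  have "V \<inter> S \<noteq> {}" if V: "open V" "x \<in> V" for V
  proof -
    obtain d where d: "d \<in> D" "\<forall>e\<in>D. (d, e) \<in> r \<longrightarrow> u e \<in> V"
      using lim[unfolded tendsto_net_filter[OF dir], rule_format, OF V] by (elim bexE)
    have "(d, d) \<in> r" using dir d(1) by (simp add: directed_set_def preorder_on_def refl_on_def)
    then have "u d \<in> V" using d by simp
    moreover have "u d \<in> S" using d(1) S by (simp add: image_subset_iff)
    ultimately have "u d \<in> V \<inter> S" by simp
    then show ?thesis by auto
  qed
  from this[of "- closure S"] show "x \<in> closure S"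
    using closure_subset[of S] by auto
qed

definition cone_usc_on ::
    "'z::real_topological_vector_space set \<Rightarrow> 'x::topological_space set \<Rightarrow> ('x \<Rightarrow> 'z) \<Rightarrow> bool" where
  "cone_usc_on C K f \<longleftrightarrow>
     (\<forall>x\<in>K. \<forall>V. open V \<and> f x \<in> V \<longrightarrow>
       (\<exists>U. open U \<and> x \<in> U \<and> (\<forall>u\<in>U \<inter> K. f u \<in> {v - c | v c. v \<in> V \<and> c \<in> C})))"

text \<open>Convexity of the domain \<open>K\<close> is not part of this definition and has to be assumed separately.\<close>

definition cone_convex_on ::
    "'z::real_vector set \<Rightarrow> 'x::real_vector set \<Rightarrow> ('x \<Rightarrow> 'z) \<Rightarrow> bool" where
  "cone_convex_on C K f \<longleftrightarrow>
     (\<forall>x\<in>K. \<forall>y\<in>K. \<forall>t\<in>{0..1}.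
       t *\<^sub>R f x + (1 - t) *\<^sub>R f y - f (t *\<^sub>R x + (1 - t) *\<^sub>R y) \<in> C)"

end

theory Submission
  imports Defs
begin

text \<open>
  Put \<open>G y = {x \<in> K. F x y x \<notin> - interior C}\<close>; the theorem says that the sets \<open>G y\<close> have a common
  point. This is an application of the Knaster--Kuratowski--Mazurkiewicz principle in the form of
  Ky Fan (\<open>kkm_compact\<close>), which needs three properties of \<open>G\<close>.

  \<^item> Each \<open>G y\<close> is closed. The set \<open>- interior C\<close> is open and absorbs subtraction of elements of
    \<open>C\<close> (\<open>neg_interior_diff\<close>). Under (b) or (c), membership \<open>F x y x \<in> - interior C\<close> at the limit of a
    net in \<open>G y\<close> would therefore spread to a point of the net; (a) is closedness in \<open>K\<close> itself.

  \<^item> The convex hull of a finite set \<open>S \<subseteq> K\<close> is covered by the sets \<open>G y\<close> with \<open>y \<in> S\<close>. By cone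
    convexity, for fixed \<open>x\<close> the \<open>y\<close> with \<open>F x y x \<in> - interior C\<close> form a convex set. If \<open>x\<close> in the hull of
    \<open>S\<close> lies in no \<open>G y\<close>, this set contains \<open>S\<close> and hence \<open>x\<close> itself, contradicting (iii).

  \<^item> Coercivity (iv) puts one of the sets, \<open>G y0\<close>, inside a compact set, so that it is enough to
    intersect finitely many of them.

  The finite case (\<open>kkm_finite\<close>) takes place in a simplex whose dimension depends on the number
  of sets, and reduces to Brouwer's fixed point theorem there. That dimension is a natural number
  bound inside the argument, so Brouwer's theorem is needed for a cube in the space
  \<open>nat \<Rightarrow> real\<close> with the dimension as a parameter (\<open>brouwer_unit_cube\<close>); it is derived from Kuhn's
  combinatorial lemma.
\<close>

section \<open>Brouwer's theorem with the dimension as a number\<close>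

text \<open>The coordinates from \<open>n\<close> on are fixed to zero, which makes the cube a compact subset of the
  metrizable product space \<open>nat \<Rightarrow> real\<close>.\<close>

definition unit_cube :: "nat \<Rightarrow> (nat \<Rightarrow> real) set" where
  "unit_cube n = {x. (\<forall>i<n. 0 \<le> x i \<and> x i \<le> 1) \<and> (\<forall>i\<ge>n. x i = 0)}"

lemma compact_unit_cube: "compact (unit_cube n)"
proof -
  have eq: "unit_cube n = (\<Pi>\<^sub>E i\<in>UNIV. if i < n then {0..1} else {0})"
    by (auto simp: unit_cube_def PiE_iff split: if_splits)
  have "compactin (product_topology (\<lambda>_. euclidean) UNIV) (unit_cube n)"
    unfolding eq compactin_PiE by auto
  then show ?thesis by (simp add: euclidean_product_topology)
qed

lemma tendsto_fun_iff:
  fixes f :: "'a \<Rightarrow> 'i \<Rightarrow> 'b::topological_space"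
  shows "(f \<longlongrightarrow> l) F \<longleftrightarrow> (\<forall>i. ((\<lambda>a. f a i) \<longlongrightarrow> l i) F)"
  using limitin_componentwise[of "\<lambda>_. euclidean" UNIV f l F]
  by (simp add: euclidean_product_topology)

text \<open>Label a point of the grid of mesh \<open>1 / Suc p\<close> in coordinate \<open>i\<close> by whether \<open>f\<close> moves it up or
  down. Kuhn's lemma finds a small grid cube in which, for every coordinate, both labels occur. As the
  mesh shrinks these cubes accumulate at a single point, where by continuity \<open>f\<close> can
  neither raise nor lower any coordinate.\<close>

lemma brouwer_unit_cube:
  fixes f :: "(nat \<Rightarrow> real) \<Rightarrow> nat \<Rightarrow> real"
  assumes cont: "\<And>i. i < n \<Longrightarrow> continuous_on (unit_cube n) (\<lambda>x. f x i)"
    and bounds: "\<And>x i. x \<in> unit_cube n \<Longrightarrow> i < n \<Longrightarrow> 0 \<le> f x i \<and> f x i \<le> 1"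
  shows "\<exists>x\<in>unit_cube n. \<forall>i<n. f x i = x i"
proof -
  define pt :: "nat \<Rightarrow> (nat \<Rightarrow> nat) \<Rightarrow> nat \<Rightarrow> real"
    where "pt p q = (\<lambda>i. if i < n then real (q i) / real (Suc p) else 0)" for p q
  have pt_cube: "pt p q \<in> unit_cube n" if "\<forall>i<n. q i \<le> Suc p" for p q
  proof -
    have "real (q i) \<le> 1 + real p" if "i < n" for i
      using \<open>\<forall>i<n. q i \<le> Suc p\<close> that by (metis of_nat_Suc of_nat_le_iff)
    then show ?thesis by (auto simp: pt_def unit_cube_def divide_le_eq)
  qed
  have grid: "\<exists>q. (\<forall>i<n. q i \<le> Suc p) \<and> (\<forall>i<n.
      (\<exists>r. (\<forall>j<n. q j \<le> r j \<and> r j \<le> q j + 1) \<and> pt p r \<in> unit_cube n \<and> pt p r i \<le> f (pt p r) i) \<and>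
      (\<exists>s. (\<forall>j<n. q j \<le> s j \<and> s j \<le> q j + 1) \<and> pt p s \<in> unit_cube n \<and> f (pt p s) i \<le> pt p s i))" for p
  proof -
    \<comment> \<open>On the faces of the cube the label prescribed by Kuhn's lemma is still truthful, because \<open>f\<close>
      maps into the cube.\<close>
    define label :: "(nat \<Rightarrow> nat) \<Rightarrow> nat \<Rightarrow> nat" where
      "label x i = (if x i = Suc p then 1 else if x i = 0 then 0
        else if pt p x i \<le> f (pt p x) i then 0 else 1)" for x i
    obtain q where q: "\<forall>i<n. q i < Suc p"
      and rs: "\<forall>i<n. \<exists>r s. (\<forall>j<n. q j \<le> r j \<and> r j \<le> q j + 1) \<and>
        (\<forall>j<n. q j \<le> s j \<and> s j \<le> q j + 1) \<and> label r i \<noteq> label s i"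
      by (rule kuhn_lemma[of "Suc p" n label]) (auto simp: label_def)
    have up: "pt p x i \<le> f (pt p x) i"
      if "\<forall>i<n. x i \<le> Suc p" "i < n" "label x i = 0" for x i
      using that bounds[OF pt_cube[OF that(1)] that(2)]
      by (auto simp: label_def pt_def split: if_splits)
    have down: "f (pt p x) i \<le> pt p x i"
      if "\<forall>i<n. x i \<le> Suc p" "i < n" "label x i \<noteq> 0" for x i
      using that bounds[OF pt_cube[OF that(1)] that(2)]
      by (auto simp: label_def pt_def split: if_splits)
    show ?thesis
    proof (rule exI[of _ q], intro conjI allI impI)
      fix i assume "i < n" then show "q i \<le> Suc p" using q by (simp add: less_imp_le)
    next
      fix i assume i: "i < n"
      from rs[rule_format, OF i] obtain a b where
        ab: "\<forall>j<n. q j \<le> a j \<and> a j \<le> q j + 1" "\<forall>j<n. q j \<le> b j \<and> b j \<le> q j + 1"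
        "label a i \<noteq> label b i" by (elim exE conjE)
      have "\<exists>r. (\<forall>j<n. q j \<le> r j \<and> r j \<le> q j + 1) \<and> label r i = 0"
      proof (cases "label a i = 0")
        case False
        then have "label b i = 0" using ab(3) by (simp add: label_def split: if_splits)
        then show ?thesis using ab(2) by (intro exI[of _ b] conjI)
      qed (use ab(1) in \<open>intro exI[of _ a] conjI\<close>)
      then obtain r where r: "\<forall>j<n. q j \<le> r j \<and> r j \<le> q j + 1" "label r i = 0"
        by (elim exE conjE)
      have "\<exists>s. (\<forall>j<n. q j \<le> s j \<and> s j \<le> q j + 1) \<and> label s i \<noteq> 0"
      proof (cases "label a i = 0")
        case True
        then have "label b i \<noteq> 0" using ab(3) by simp
        then show ?thesis using ab(2) by (intro exI[of _ b] conjI)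
      qed (use ab(1) in \<open>intro exI[of _ a] conjI\<close>)
      then obtain s where s: "\<forall>j<n. q j \<le> s j \<and> s j \<le> q j + 1" "label s i \<noteq> 0"
        by (elim exE conjE)
      have le: "\<forall>j<n. x j \<le> Suc p" if "\<forall>j<n. q j \<le> x j \<and> x j \<le> q j + 1" for x
        using that q by fastforce
      show "\<exists>r. (\<forall>j<n. q j \<le> r j \<and> r j \<le> q j + 1) \<and> pt p r \<in> unit_cube n \<and> pt p r i \<le> f (pt p r) i"
        using r pt_cube[OF le[OF r(1)]] up[OF le[OF r(1)] i r(2)] by blast
      show "\<exists>s. (\<forall>j<n. q j \<le> s j \<and> s j \<le> q j + 1) \<and> pt p s \<in> unit_cube n \<and> f (pt p s) i \<le> pt p s i"
        using s pt_cube[OF le[OF s(1)]] down[OF le[OF s(1)] i s(2)] by blast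
    qed
  qed
  then obtain q where q: "\<And>p. \<forall>i<n. q p i \<le> Suc p"
    and rs: "\<And>p i. i < n \<Longrightarrow>
      (\<exists>r. (\<forall>j<n. q p j \<le> r j \<and> r j \<le> q p j + 1) \<and> pt p r \<in> unit_cube n \<and> pt p r i \<le> f (pt p r) i) \<and>
      (\<exists>s. (\<forall>j<n. q p j \<le> s j \<and> s j \<le> q p j + 1) \<and> pt p s \<in> unit_cube n \<and> f (pt p s) i \<le> pt p s i)"
    by metis
  have "seq_compact (unit_cube n)"
    using compact_unit_cube compact_imp_seq_compact by blast
  then obtain x \<sigma> where x: "x \<in> unit_cube n" and \<sigma>: "strict_mono \<sigma>"
    and lim: "((\<lambda>p. pt p (q p)) \<circ> \<sigma>) \<longlonglongrightarrow> x"
    unfolding seq_compact_def using pt_cube[OF q] by metis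
  \<comment> \<open>All points chosen from the grid cubes at \<open>q (\<sigma> k)\<close> share the limit of the corners.\<close>
  have near: "(\<lambda>k. pt (\<sigma> k) (a k)) \<longlonglongrightarrow> x"
    if a: "\<And>k. \<forall>j<n. q (\<sigma> k) j \<le> a k j \<and> a k j \<le> q (\<sigma> k) j + 1" for a
    unfolding tendsto_fun_iff
  proof
    fix j
    have qj: "(\<lambda>k. pt (\<sigma> k) (q (\<sigma> k)) j) \<longlonglongrightarrow> x j"
      using lim by (simp add: tendsto_fun_iff o_def)
    have "(\<lambda>k. inverse (real (Suc (\<sigma> k)))) \<longlonglongrightarrow> 0"
      using LIMSEQ_subseq_LIMSEQ[OF LIMSEQ_inverse_real_of_nat \<sigma>] by (simp add: o_def)
    then have up: "(\<lambda>k. pt (\<sigma> k) (q (\<sigma> k)) j + inverse (real (Suc (\<sigma> k)))) \<longlonglongrightarrow> x j"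
      using tendsto_add[OF qj] by fastforce
    have "pt (\<sigma> k) (q (\<sigma> k)) j \<le> pt (\<sigma> k) (a k) j \<and>
        pt (\<sigma> k) (a k) j \<le> pt (\<sigma> k) (q (\<sigma> k)) j + inverse (real (Suc (\<sigma> k)))" for k
    proof (cases "j < n")
      case True
      then have "real (q (\<sigma> k) j) \<le> real (a k j)" "real (a k j) \<le> real (q (\<sigma> k) j) + 1"
        using a[of k] by (metis of_nat_le_iff, metis of_nat_1 of_nat_add of_nat_le_iff)
      then have "real (q (\<sigma> k) j) / real (Suc (\<sigma> k)) \<le> real (a k j) / real (Suc (\<sigma> k))"
        "real (a k j) / real (Suc (\<sigma> k)) \<le> (real (q (\<sigma> k) j) + 1) / real (Suc (\<sigma> k))"
        by (intro divide_right_mono; simp)+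
      then show ?thesis
        using True by (simp add: pt_def add_divide_distrib inverse_eq_divide)
    qed (simp add: pt_def)
    then show "(\<lambda>k. pt (\<sigma> k) (a k) j) \<longlonglongrightarrow> x j"
      by (intro tendsto_sandwich[OF _ _ qj up]) auto
  qed
  have "f x i = x i" if i: "i < n" for i
  proof (rule antisym)
    have "\<forall>k. \<exists>s. (\<forall>j<n. q (\<sigma> k) j \<le> s j \<and> s j \<le> q (\<sigma> k) j + 1) \<and>
      pt (\<sigma> k) s \<in> unit_cube n \<and> f (pt (\<sigma> k) s) i \<le> pt (\<sigma> k) s i"
      using rs[OF i] by blast
    then obtain s where "\<forall>k. (\<forall>j<n. q (\<sigma> k) j \<le> s k j \<and> s k j \<le> q (\<sigma> k) j + 1) \<and>
      pt (\<sigma> k) (s k) \<in> unit_cube n \<and> f (pt (\<sigma> k) (s k)) i \<le> pt (\<sigma> k) (s k) i"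
      by (rule choice[THEN exE])
    then have s: "\<And>k. \<forall>j<n. q (\<sigma> k) j \<le> s k j \<and> s k j \<le> q (\<sigma> k) j + 1"
      "\<And>k. pt (\<sigma> k) (s k) \<in> unit_cube n" "\<And>k. f (pt (\<sigma> k) (s k)) i \<le> pt (\<sigma> k) (s k) i"
      by auto
    have "(\<lambda>k. f (pt (\<sigma> k) (s k)) i) \<longlonglongrightarrow> f x i"
      by (rule continuous_on_tendsto_compose[OF cont[OF i] near[OF s(1)] x]) (simp add: s)
    moreover have "(\<lambda>k. pt (\<sigma> k) (s k) i) \<longlonglongrightarrow> x i"
      using near[OF s(1)] by (simp add: tendsto_fun_iff)
    ultimately show "f x i \<le> x i" using s(3) by (meson LIMSEQ_le)
    have "\<forall>k. \<exists>r. (\<forall>j<n. q (\<sigma> k) j \<le> r j \<and> r j \<le> q (\<sigma> k) j + 1) \<and>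
      pt (\<sigma> k) r \<in> unit_cube n \<and> pt (\<sigma> k) r i \<le> f (pt (\<sigma> k) r) i"
      using rs[OF i] by blast
    then obtain r where "\<forall>k. (\<forall>j<n. q (\<sigma> k) j \<le> r k j \<and> r k j \<le> q (\<sigma> k) j + 1) \<and>
      pt (\<sigma> k) (r k) \<in> unit_cube n \<and> pt (\<sigma> k) (r k) i \<le> f (pt (\<sigma> k) (r k)) i"
      by (rule choice[THEN exE])
    then have r: "\<And>k. \<forall>j<n. q (\<sigma> k) j \<le> r k j \<and> r k j \<le> q (\<sigma> k) j + 1"
      "\<And>k. pt (\<sigma> k) (r k) \<in> unit_cube n" "\<And>k. pt (\<sigma> k) (r k) i \<le> f (pt (\<sigma> k) (r k)) i"
      by auto
    have "(\<lambda>k. f (pt (\<sigma> k) (r k)) i) \<longlonglongrightarrow> f x i"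
      by (rule continuous_on_tendsto_compose[OF cont[OF i] near[OF r(1)] x]) (simp add: r)
    moreover have "(\<lambda>k. pt (\<sigma> k) (r k) i) \<longlonglongrightarrow> x i"
      using near[OF r(1)] by (simp add: tendsto_fun_iff)
    ultimately show "x i \<le> f x i" using r(3) by (meson LIMSEQ_le)
  qed
  with x show ?thesis by blast
qed

section \<open>Interiors of convex cones in topological vector spaces\<close>

lemma tendsto_scaleR_tvs:
  fixes g :: "'a \<Rightarrow> 'x::real_topological_vector_space"
  assumes "(f \<longlongrightarrow> a) F" "(g \<longlongrightarrow> x) F"
  shows "((\<lambda>t. f t *\<^sub>R g t) \<longlongrightarrow> a *\<^sub>R x) F"
  using filterlim_compose[OF tendsto_scaleR_Pair filterlim_Pair[OF assms]] by simp

lemma continuous_on_scaleR_tvs: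
  fixes g :: "'a::topological_space \<Rightarrow> 'x::real_topological_vector_space"
  assumes "continuous_on S f" "continuous_on S g"
  shows "continuous_on S (\<lambda>t. f t *\<^sub>R g t)"
  using assms unfolding continuous_on_def by (blast intro: tendsto_scaleR_tvs)

text \<open>For \<open>s > 0\<close>, the open set \<open>s *\<^sub>R interior C + t *\<^sub>R b\<close> lies in \<open>C\<close> by convexity and contains the convex
  combination; it is written as a preimage so that its openness follows from continuity.\<close>

lemma convex_interior_tvs:
  fixes C :: "'z::real_topological_vector_space set"
  assumes "convex C"
  shows "convex (interior C)"
proof (rule convexI)
  fix a b and s t :: real
  assume ab: "a \<in> interior C" "b \<in> interior C" and st: "0 \<le> s" "0 \<le> t" "s + t = 1"
  show "s *\<^sub>R a + t *\<^sub>R b \<in> interior C"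
  proof (cases "s = 0")
    case True
    then show ?thesis using ab st by simp
  next
    case False
    let ?g = "\<lambda>z. (1 / s) *\<^sub>R (z - t *\<^sub>R b)"
    show ?thesis
    proof (rule interiorI)
      show "open (?g -` interior C)"
        by (intro open_vimage open_interior continuous_on_scaleR_tvs continuous_intros)
      show "s *\<^sub>R a + t *\<^sub>R b \<in> ?g -` interior C" using ab False by simp
      show "?g -` interior C \<subseteq> C"
      proof
        fix z assume "z \<in> ?g -` interior C"
        then have "s *\<^sub>R ?g z + t *\<^sub>R b \<in> C"
          using ab interior_subset by (intro convexD[OF assms _ _ st]) auto
        then show "z \<in> C" using False by simp
      qed
    qed
  qed
qed

lemma interior_cone_add:
  fixes C :: "'z::real_topological_vector_space set"
  assumes "convex C" "cone C" and a: "a \<in> interior C" and c: "c \<in> C"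
  shows "a + c \<in> interior C"
proof (rule interiorI)
  show "open ((\<lambda>z. z - c) -` interior C)"
    by (intro open_vimage open_interior continuous_intros)
  show "a + c \<in> (\<lambda>z. z - c) -` interior C" using a by simp
  show "(\<lambda>z. z - c) -` interior C \<subseteq> C"
  proof
    fix z assume "z \<in> (\<lambda>z. z - c) -` interior C"
    then have "(z - c) + c \<in> C"
      using c interior_subset convex_cone[of C] assms(1,2) by blast
    then show "z \<in> C" by simp
  qed
qed

text \<open>Lowering a point in the order of \<open>C\<close> cannot leave \<open>- interior C\<close>. Cone upper semicontinuity, its
  net version and cone convexity all give bounds in this order, and this is how they are used.\<close>

lemma neg_interior_diff:
  fixes C :: "'z::real_topological_vector_space set"
  assumes C: "convex C" "cone C" and z: "z \<in> uminus ` interior C" and c: "z - w \<in> C"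
  shows "w \<in> uminus ` interior C"
proof -
  from z have "- z \<in> interior C" by auto
  then have "- z + (z - w) \<in> interior C" by (rule interior_cone_add[OF C _ c])
  then show ?thesis by (simp add: image_iff) (metis minus_minus)
qed

lemma open_neg_interior:
  fixes C :: "'z::real_topological_vector_space set"
  shows "open (uminus ` interior C)"
proof -
  have "uminus ` interior C = uminus -` interior C" by (auto simp: image_iff) (metis minus_minus)
  then show ?thesis by (simp add: open_vimage continuous_on_minus continuous_on_id)
qed

section \<open>The Knaster--Kuratowski--Mazurkiewicz principle\<close>

text \<open>Pull the sets \<open>G i\<close> back to closed subsets \<open>A i\<close> of the standard simplex along the barycentric map.
  If they had no common point, the distances \<open>d t i\<close> from \<open>t\<close> to \<open>A i\<close> would have a positive sum, and
  \<open>t \<mapsto> d t / sum (d t)\<close> would be a continuous self-map of the simplex. At a fixed point, \<open>t i > 0\<close>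
  exactly when \<open>t \<notin> A i\<close>; but the covering hypothesis for the face spanned by the positive coordinates
  of \<open>t\<close> provides an \<open>i\<close> with \<open>t i > 0\<close> and \<open>t \<in> A i\<close>.\<close>

lemma kkm_finite:
  fixes y :: "nat \<Rightarrow> 'x::real_topological_vector_space"
  assumes closed: "\<And>i. i < n \<Longrightarrow> closed (G i)"
    and cover: "\<And>I. I \<subseteq> {..<n} \<Longrightarrow> I \<noteq> {} \<Longrightarrow> convex hull (y ` I) \<subseteq> (\<Union>i\<in>I. G i)"
  shows "(\<Inter>i<n. G i) \<noteq> {}"
proof (cases "n = 0")
  case False
  define \<Delta> :: "(nat \<Rightarrow> real) set"
    where "\<Delta> = {t. (\<forall>i. 0 \<le> t i) \<and> (\<forall>i\<ge>n. t i = 0) \<and> (\<Sum>i<n. t i) = 1}"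
  define \<phi> where "\<phi> t = (\<Sum>i<n. t i *\<^sub>R y i)" for t
  define A where "A i = \<Delta> \<inter> \<phi> -` G i" for i
  have cont_\<phi>: "continuous_on UNIV \<phi>"
    unfolding \<phi>_def by (intro continuous_on_sum continuous_on_scaleR_tvs continuous_on_const continuous_on_product_coordinates)
  have coord: "continuous_on S (\<lambda>t. t i)" for S :: "(nat \<Rightarrow> real) set" and i
    by (rule continuous_on_subset[OF continuous_on_product_coordinates subset_UNIV])
  have "closed ((\<Inter>i. {t. 0 \<le> t i}) \<inter> (\<Inter>i\<in>{n..}. {t. t i = 0}) \<inter> {t. (\<Sum>i<n. t i) = (1::real)})"
    by (intro closed_Int closed_INT ballI closed_Collect_le closed_Collect_eq
        continuous_on_sum coord continuous_on_const)
  moreover have "\<Delta> = (\<Inter>i. {t. 0 \<le> t i}) \<inter> (\<Inter>i\<in>{n..}. {t. t i = 0}) \<inter> {t. (\<Sum>i<n. t i) = 1}"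
    by (auto simp: \<Delta>_def)
  ultimately have "closed \<Delta>" by simp
  then have closed_A: "closed (A i)" if "i < n" for i
    unfolding A_def using closed[OF that] cont_\<phi> by (intro closed_Int closed_vimage)
  have face: "\<exists>i<n. 0 < t i \<and> t \<in> A i" if t: "t \<in> \<Delta>" for t
  proof -
    define I where "I = {i. i < n \<and> 0 < t i}"
    have zero: "t i = 0" if "i \<in> {..<n} - I" for i
      using t that by (auto simp: I_def \<Delta>_def order.antisym not_less)
    have I: "finite I" "I \<subseteq> {..<n}" by (auto simp: I_def)
    have sumI: "sum t I = 1"
      using sum.mono_neutral_left[OF _ I(2), of t] zero t by (simp add: \<Delta>_def)
    then have "I \<noteq> {}" by auto
    have "\<phi> t = (\<Sum>i\<in>I. t i *\<^sub>R y i)"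
      unfolding \<phi>_def by (rule sum.mono_neutral_right) (use I zero in auto)
    also have "\<dots> \<in> convex hull (y ` I)"
      using t sumI by (intro convex_sum I convex_convex_hull) (auto simp: \<Delta>_def intro: hull_inc)
    finally show ?thesis
      using cover[OF I(2) \<open>I \<noteq> {}\<close>] t by (auto simp: A_def I_def)
  qed
  have A_ne: "A i \<noteq> {}" if i: "i < n" for i
  proof -
    have "(\<lambda>j. if j = i then 1 else 0) \<in> \<Delta>" using i by (simp add: \<Delta>_def)
    from face[OF this] show ?thesis by (auto split: if_splits)
  qed
  have A_iff: "t \<in> A i \<longleftrightarrow> infdist t (A i) = 0" if "i < n" for t i
    using in_closed_iff_infdist_zero[OF closed_A A_ne] that by blast
  have "\<exists>t. \<forall>i<n. t \<in> A i"
  proof (rule ccontr)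
    assume none: "\<nexists>t. \<forall>i<n. t \<in> A i"
    define d where "d t i = infdist t (A i)" for t i
    have d_nonneg: "0 \<le> d t i" for t i by (simp add: d_def infdist_nonneg)
    have sum_pos: "0 < (\<Sum>i<n. d t i)" for t
    proof -
      obtain i where "i < n" "t \<notin> A i" using none by blast
      then have "0 < d t i" using A_iff[of i t] d_nonneg[of t i] by (simp add: d_def)
      then show ?thesis using \<open>i < n\<close> d_nonneg by (intro sum_pos2[of _ i]) auto
    qed
    \<comment> \<open>A retraction of the cube onto the simplex: a coordinate sum below 1 is raised to 1 by a
      uniform shift, and one above 1 is scaled down. It turns the self-map of the simplex into a
      self-map of the cube with the same fixed points.\<close>
    define \<rho> where "\<rho> t = (\<lambda>i. if i < n
      then (t i + max 0 (1 - (\<Sum>j<n. t j)) / real n) / max 1 (\<Sum>j<n. t j) else 0)" for t :: "nat \<Rightarrow> real"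
    have \<rho>_id: "\<rho> t = t" if "t \<in> \<Delta>" for t
      using that by (auto simp: \<rho>_def \<Delta>_def)
    have "continuous_on UNIV (\<lambda>t. \<rho> t i)" for i
      unfolding \<rho>_def by (cases "i < n") (auto intro!: continuous_intros coord)
    then have cont_\<rho>: "continuous_on UNIV \<rho>"
      by (rule continuous_on_coordinatewise_then_product)
    have "\<exists>t\<in>unit_cube n. \<forall>i<n. d (\<rho> t) i / (\<Sum>j<n. d (\<rho> t) j) = t i"
    proof (rule brouwer_unit_cube)
      fix i assume "i < n"
      have "continuous_on (unit_cube n) (\<lambda>t. d (\<rho> t) j)" for j
        unfolding d_def using cont_\<rho> by (intro continuous_on_infdist) (rule continuous_on_subset, auto)
      then show "continuous_on (unit_cube n) (\<lambda>t. d (\<rho> t) i / (\<Sum>j<n. d (\<rho> t) j))"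
        using sum_pos by (intro continuous_intros) (auto simp: less_imp_neq[symmetric])
    next
      fix t i assume "i < n"
      then have "d (\<rho> t) i \<le> (\<Sum>j<n. d (\<rho> t) j)"
        using d_nonneg by (intro member_le_sum) auto
      then show "0 \<le> d (\<rho> t) i / (\<Sum>j<n. d (\<rho> t) j) \<and> d (\<rho> t) i / (\<Sum>j<n. d (\<rho> t) j) \<le> 1"
        using sum_pos[of "\<rho> t"] d_nonneg by (simp add: divide_le_eq)
    qed
    then obtain t where t: "t \<in> unit_cube n" and fp: "\<And>i. i < n \<Longrightarrow> d (\<rho> t) i / (\<Sum>j<n. d (\<rho> t) j) = t i"
      by blast
    have "(\<Sum>i<n. t i) = (\<Sum>i<n. d (\<rho> t) i / (\<Sum>j<n. d (\<rho> t) j))"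
      using fp by (intro sum.cong) auto
    also have "\<dots> = 1" using sum_pos[of "\<rho> t"] by (simp flip: sum_divide_distrib)
    finally have "(\<Sum>i<n. t i) = 1" .
    then have "t \<in> \<Delta>" using t by (auto simp: \<Delta>_def unit_cube_def) (metis le_cases not_le order_refl)
    then obtain i where i: "i < n" "0 < t i" "t \<in> A i" using face by blast
    then have "d (\<rho> t) i = 0" using \<rho>_id[OF \<open>t \<in> \<Delta>\<close>] A_iff by (simp add: d_def)
    then show False using fp[OF i(1)] i(2) by simp
  qed
  then show ?thesis by (auto simp: A_def)
qed simp

text \<open>Adjoining \<open>y0\<close> to any finite subfamily keeps its intersection inside the compact set, so the
  finite intersection property there reduces the claim to finitely many sets.\<close>

lemma kkm_compact:
  fixes G :: "'x::real_topological_vector_space \<Rightarrow> 'x set"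
  assumes closed: "\<And>y. y \<in> Y \<Longrightarrow> closed (G y)"
    and cover: "\<And>S. finite S \<Longrightarrow> S \<subseteq> Y \<Longrightarrow> convex hull S \<subseteq> (\<Union>y\<in>S. G y)"
    and y0: "y0 \<in> Y" "G y0 \<subseteq> B" "compact B"
  shows "(\<Inter>y\<in>Y. G y) \<noteq> {}"
proof -
  have "B \<inter> (\<Inter>y\<in>Y. G y) \<noteq> {}"
  proof (rule compact_imp_fip_image[OF y0(3) closed])
    fix S assume S: "finite S" "S \<subseteq> Y"
    obtain e and n :: nat where e: "insert y0 S = e ` {..<n}"
      using finite_imp_nat_seg_image_inj_on[of "insert y0 S"] S(1) by (auto simp: lessThan_def)
    have "(\<Inter>i<n. G (e i)) \<noteq> {}"
    proof (rule kkm_finite)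
      show "closed (G (e i))" if "i < n" for i
      proof (rule closed)
        have "e i \<in> insert y0 S" unfolding e using that by simp
        then show "e i \<in> Y" using y0(1) S(2) by blast
      qed
      show "convex hull (e ` I) \<subseteq> (\<Union>i\<in>I. G (e i))" if "I \<subseteq> {..<n}" for I
      proof -
        have "e ` I \<subseteq> insert y0 S" unfolding e using that by (rule image_mono)
        then have "e ` I \<subseteq> Y" using y0(1) S(2) by blast
        then show ?thesis using cover[of "e ` I"] finite_subset[OF that] by auto
      qed
    qed
    then have "(\<Inter>y\<in>insert y0 S. G y) \<noteq> {}" unfolding e by simp
    then show "B \<inter> (\<Inter>y\<in>S. G y) \<noteq> {}" using y0(2) by auto
  qed
  then show ?thesis by blast
qed

section \<open>Existence of equilibria\<close>

text \<open>Nets indexed by pairs of a set and a point suffice to detect closedness, since they describe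
  closures.\<close>

lemma closed_if_net_closed:
  fixes S :: "'x::topological_space set"
  assumes "\<And>(D :: 'x net_index set) r u x. directed_set D r \<Longrightarrow> u ` D \<subseteq> S \<Longrightarrow>
    (u \<longlongrightarrow> x) (net_filter D r) \<Longrightarrow> x \<in> S"
  shows "closed S"
proof -
  have "closure S \<subseteq> S"
  proof
    fix x assume "x \<in> closure S"
    then obtain D :: "'x net_index set" and r u where
      "directed_set D r" "u ` D \<subseteq> S" "(u \<longlongrightarrow> x) (net_filter D r)"
      unfolding closure_net by (elim exE conjE)
    then show "x \<in> S" by (rule assms)
  qed
  then show ?thesis using closure_subset[of S] closure_eq[of S] by auto
qed

theorem theorem3p7:
  fixes C :: "'z::{real_topological_vector_space, t2_space} set"
    and K :: "'x::{real_topological_vector_space, t2_space} set"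
    and F :: "'x \<Rightarrow> 'x \<Rightarrow> 'x \<Rightarrow> 'z"
  assumes C: "convex_pointed_cone C" "interior C \<noteq> {}"
    and K: "K \<noteq> {}" "convex K" "closed K"
    and i: "\<And>y. y \<in> K \<Longrightarrow>
        (\<forall>(D :: 'x net_index set) r u. \<forall>x\<in>K.
            directed_set D r \<and> u ` D \<subseteq> K \<and> (u \<longlongrightarrow> x) (net_filter D r) \<longrightarrow>
            (\<forall>d\<in>D. F (u d) y (u d) \<notin> uminus ` interior C) \<longrightarrow>
            F x y x \<notin> uminus ` interior C)
        \<or> cone_usc_on C K (\<lambda>x. F x y x)
        \<or> (\<forall>x\<in>K. \<forall>(D :: 'x net_index set) r u.
            directed_set D r \<and> u ` D \<subseteq> K \<and> (u \<longlongrightarrow> x) (net_filter D r) \<longrightarrow>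
            (\<exists>w z. (w \<longlongrightarrow> z) (net_filter D r) \<and>
                   (\<forall>d\<in>D. F (u d) y (u d) - w d \<in> uminus ` C) \<and>
                   F x y x - z \<in> C))"
    and ii: "\<And>x. x \<in> K \<Longrightarrow> cone_convex_on C K (\<lambda>y. F x y x)"
    and iii: "\<And>x. x \<in> K \<Longrightarrow> F x x x \<notin> uminus ` interior C"
    and iv: "\<exists>K0 y0. K0 \<noteq> {} \<and> compact K0 \<and> y0 \<in> K \<and>
        (\<forall>x\<in>K - K0. F x y0 x \<in> uminus ` interior C)"
  shows "\<exists>x0\<in>K. \<forall>y\<in>K. F x0 y x0 \<notin> uminus ` interior C"
proof -
  let ?N = "uminus ` interior C"
  define G where "G y = {x \<in> K. F x y x \<notin> ?N}" for y
  have "a + b \<in> C" if "a \<in> C" "b \<in> C" for a b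
    using C(1) set_plus_intro[OF that] by (simp add: convex_pointed_cone_def)
  then have cone: "convex C" "cone C"
    using C(1) convex_cone[of C] by (auto simp: convex_pointed_cone_def cone_def)
  obtain K0 y0 where K0: "compact K0" "y0 \<in> K" "\<forall>x\<in>K - K0. F x y0 x \<in> ?N"
    using iv by blast
  have closed_G: "closed (G y)" if y: "y \<in> K" for y
  proof (rule closed_if_net_closed)
    fix D :: "'x net_index set" and r u x
    assume dir: "directed_set D r" and u: "u ` D \<subseteq> G y" and lim: "(u \<longlongrightarrow> x) (net_filter D r)"
    have uK: "u ` D \<subseteq> K" and uN: "\<forall>d\<in>D. F (u d) y (u d) \<notin> ?N" using u by (auto simp: G_def)
    have "x \<in> closure K" unfolding closure_net by (intro exI conjI) (fact dir uK lim)+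
    then have x: "x \<in> K" using K(3) by simp
    \<comment> \<open>Directed sets are nonempty, so an eventual property holds somewhere.\<close>
    have ex: "\<exists>d\<in>D. P d" if "eventually P (net_filter D r)" for P
      using that dir unfolding eventually_net_filter[OF dir]
      by (auto simp: directed_set_def preorder_on_def refl_on_def)
    have "F x y x \<notin> ?N"
      using i[OF y]
    proof (elim disjE)
      assume "\<forall>(D :: 'x net_index set) r u. \<forall>x\<in>K.
            directed_set D r \<and> u ` D \<subseteq> K \<and> (u \<longlongrightarrow> x) (net_filter D r) \<longrightarrow>
            (\<forall>d\<in>D. F (u d) y (u d) \<notin> ?N) \<longrightarrow> F x y x \<notin> ?N"
      then show ?thesis using x dir uK lim uN by blast
    next
      assume usc: "cone_usc_on C K (\<lambda>x. F x y x)"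
      show ?thesis
      proof
        assume "F x y x \<in> ?N"
        then obtain U where U: "open U" "x \<in> U"
          "\<forall>u\<in>U \<inter> K. F u y u \<in> {v - c | v c. v \<in> ?N \<and> c \<in> C}"
          using usc x open_neg_interior unfolding cone_usc_on_def by blast
        have "eventually (\<lambda>d. u d \<in> U) (net_filter D r)"
          using lim U(1,2) by (rule topological_tendstoD)
        then obtain d where d: "d \<in> D" "u d \<in> U" using ex by blast
        then obtain v c where "F (u d) y (u d) = v - c" "v \<in> ?N" "c \<in> C"
          using U(3) uK by blast
        then have "F (u d) y (u d) \<in> ?N" using neg_interior_diff[OF cone] by simp
        then show False using uN d(1) by blast
      qed
    next
      assume "\<forall>x\<in>K. \<forall>(D :: 'x net_index set) r u.
            directed_set D r \<and> u ` D \<subseteq> K \<and> (u \<longlongrightarrow> x) (net_filter D r) \<longrightarrow>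
            (\<exists>w z. (w \<longlongrightarrow> z) (net_filter D r) \<and>
                   (\<forall>d\<in>D. F (u d) y (u d) - w d \<in> uminus ` C) \<and> F x y x - z \<in> C)"
      then obtain w z where w: "(w \<longlongrightarrow> z) (net_filter D r)"
        "\<forall>d\<in>D. F (u d) y (u d) - w d \<in> uminus ` C" "F x y x - z \<in> C"
        using x dir uK lim by metis
      show ?thesis
      proof
        assume "F x y x \<in> ?N"
        then have "z \<in> ?N" using neg_interior_diff[OF cone] w(3) by blast
        then have "eventually (\<lambda>d. w d \<in> ?N) (net_filter D r)"
          using topological_tendstoD[OF w(1) open_neg_interior] by blast
        then obtain d where d: "d \<in> D" "w d \<in> ?N" using ex by blast
        from w(2) d(1) obtain c where "c \<in> C" "F (u d) y (u d) - w d = - c" by blast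
        then have "w d - F (u d) y (u d) \<in> C" by (metis minus_diff_eq minus_minus)
        then have "F (u d) y (u d) \<in> ?N" using neg_interior_diff[OF cone d(2)] by blast
        then show False using uN d(1) by blast
      qed
    qed
    then show "x \<in> G y" using x by (simp add: G_def)
  qed
  have cover: "convex hull S \<subseteq> (\<Union>y\<in>S. G y)" if S: "S \<subseteq> K" for S
  proof
    fix x assume x: "x \<in> convex hull S"
    then have xK: "x \<in> K" using hull_minimal[of S K convex] S K(2) by blast
    show "x \<in> (\<Union>y\<in>S. G y)"
    proof (rule ccontr)
      assume "x \<notin> (\<Union>y\<in>S. G y)"
      then have "S \<subseteq> {y \<in> K. F x y x \<in> ?N}" using S xK by (auto simp: G_def)
      moreover have "convex {y \<in> K. F x y x \<in> ?N}"
      proof (rule convexI)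
        fix a b and s t :: real
        assume ab: "a \<in> {y \<in> K. F x y x \<in> ?N}" "b \<in> {y \<in> K. F x y x \<in> ?N}"
          and st: "0 \<le> s" "0 \<le> t" "s + t = 1"
        have t: "t = 1 - s" using st by simp
        have "s *\<^sub>R F x a x + (1 - s) *\<^sub>R F x b x \<in> ?N"
          using convexD[OF convex_negations[OF convex_interior_tvs[OF cone(1)]], of "F x a x" "F x b x" s "1 - s"] ab st by simp
        moreover have "s *\<^sub>R F x a x + (1 - s) *\<^sub>R F x b x - F x (s *\<^sub>R a + (1 - s) *\<^sub>R b) x \<in> C"
          using ii[OF xK] ab st unfolding cone_convex_on_def by simp
        ultimately have "F x (s *\<^sub>R a + (1 - s) *\<^sub>R b) x \<in> ?N" by (rule neg_interior_diff[OF cone])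
        moreover have "s *\<^sub>R a + t *\<^sub>R b \<in> K" using convexD[OF K(2)] ab st by simp
        ultimately show "s *\<^sub>R a + t *\<^sub>R b \<in> {y \<in> K. F x y x \<in> ?N}" by (simp add: t)
      qed
      ultimately have "convex hull S \<subseteq> {y \<in> K. F x y x \<in> ?N}" by (rule hull_minimal)
      then show False using x iii[OF xK] by blast
    qed
  qed
  have "(\<Inter>y\<in>K. G y) \<noteq> {}"
  proof (rule kkm_compact[OF closed_G cover K0(2) _ K0(1)])
    show "G y0 \<subseteq> K0" using K0(3) by (auto simp: G_def)
  qed
  then show ?thesis using K0(2) by (auto simp: G_def)
qed

end
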